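(* For every positive integer $n$, the initial three-row Chomp rectangle $[n,n,n]$ has exactly one winning opening move; that is, there is exactly one legal move from $[n,n,n]$ that leads to a $P$-position.
   Context: Three-row Chomp. A position is a triple $[p,q,r]$ of integers with $p\ge q\ge r\ge 0$, giving the lengths of the first, second and third rows of a left-justified board. Two players alternate moves. A move chooses a square $(i,j)$ still present (row $i$, column $j$) and removes all squares $(i',j')$ with $i'\ge i$ and $j'\ge j$. Thus the moves from $[p,q,r]$ are: reduce the first row to length $a$ with $0\le a<p$, giving $[a,\min(a,q),\min(a,r)]$; reduce the second row to length $a$ with $0\le a<q$, giving $[p,a,\min(a,r)]$; reduce the third row to length $b$ with $0\le b<r$, giving $[p,q,b]$. The player who takes the square $(1,1)$ (i.e. moves to $[0,0,0]$) loses. A $P$-position is a position from which the previous player (the one who just moved) wins, and an $N$-position is one from which the player about to move wins. Equivalently: $[0,0,0]$ is an $N$-position, and a position other than $[0,0,0]$ is a $P$-position if and only if no move from it leads to a $P$-position. A move is winning if it leads to a $P$-position. *)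

theory Defs
  imports Main
begin

text \<open>Row lengths. Only triples satisfying \<open>valid_position\<close> below are boards; moves preserve
  this (\<open>valid_chomp\<close>), so the other triples never occur in a game starting from a board.\<close>

type_synonym position = "nat \<times> nat \<times> nat"

definition valid_position :: "position \<Rightarrow> bool" where
  "valid_position = (\<lambda>(p, q, r). p \<ge> q \<and> q \<ge> r)"

text \<open>A square is a pair (row, column), both counted from 1; legal moves are identified with
  the squares present.\<close>

definition squares :: "position \<Rightarrow> (nat \<times> nat) set" where
  "squares = (\<lambda>(p, q, r).
     {(i, j). 1 \<le> j \<and> (i = 1 \<and> j \<le> p \<or> i = 2 \<and> j \<le> q \<or> i = 3 \<and> j \<le> r)})"

text \<open>Choosing the square (i, j) removes every square weakly below and to the right of it, so
  each row k with k \<ge> i is cut to length at most j - 1.\<close>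

definition chomp :: "nat \<times> nat \<Rightarrow> position \<Rightarrow> position" where
  "chomp = (\<lambda>(i, j) (p, q, r).
     (if i \<le> 1 then min p (j - 1) else p,
      if i \<le> 2 then min q (j - 1) else q,
      if i \<le> 3 then min r (j - 1) else r))"

lemma squares_chomp:
  "(i', j') \<in> squares (chomp (i, j) (p, q, r)) \<longleftrightarrow>
     (i', j') \<in> squares (p, q, r) \<and> \<not> (i \<le> i' \<and> j \<le> j')"
  by (auto simp: squares_def chomp_def)

lemma valid_chomp:
  "valid_position b \<Longrightarrow> s \<in> squares b \<Longrightarrow> valid_position (chomp s b)"
  by (auto simp: valid_position_def squares_def chomp_def)

lemma chomp_row1: "valid_position (p, q, r) \<Longrightarrow> a < p \<Longrightarrow>
    (1, a + 1) \<in> squares (p, q, r) \<and> chomp (1, a + 1) (p, q, r) = (a, min a q, min a r)"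
  by (auto simp: valid_position_def squares_def chomp_def)

lemma chomp_row2: "valid_position (p, q, r) \<Longrightarrow> a < q \<Longrightarrow>
    (2, a + 1) \<in> squares (p, q, r) \<and> chomp (2, a + 1) (p, q, r) = (p, a, min a r)"
  by (auto simp: valid_position_def squares_def chomp_def)

lemma chomp_row3: "valid_position (p, q, r) \<Longrightarrow> b < r \<Longrightarrow>
    (3, b + 1) \<in> squares (p, q, r) \<and> chomp (3, b + 1) (p, q, r) = (p, q, b)"
  by (auto simp: valid_position_def squares_def chomp_def)

lemma chomp_decreases:
  "s \<in> squares b \<Longrightarrow>
     (\<lambda>(p, q, r). p + q + r) (chomp s b) < (\<lambda>(p, q, r). p + q + r) b"
  by (auto simp: squares_def chomp_def)

text \<open>The empty board is an N-position, because the player who took the last square (1, 1)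
  has lost.\<close>

function P_position :: "position \<Rightarrow> bool" where
  "P_position b \<longleftrightarrow> b \<noteq> (0, 0, 0) \<and> \<not> (\<exists>s\<in>squares b. P_position (chomp s b))"
  by auto
termination
  by (relation "measure (\<lambda>(p, q, r). p + q + r)") (simp_all only: wf_measure in_measure chomp_decreases)

declare P_position.simps [simp del]

definition winning_move :: "position \<Rightarrow> nat \<times> nat \<Rightarrow> bool" where
  "winning_move b s \<longleftrightarrow> s \<in> squares b \<and> P_position (chomp s b)"

end

theory Submission
  imports Defs
begin

text \<open>
  By strategy stealing \<open>[n, n, n]\<close> is an N-position, so a winning move exists, and it leads to some
  \<open>[n, a, a]\<close> or some \<open>[n, n, b]\<close>. Two P-positions of the same shape are joined by a move, so only
  the coexistence of \<open>[n, a, a]\<close> and \<open>[n, n, b]\<close> has to be excluded, and there \<open>b < a < n\<close>.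
  Call a column \<open>c\<close> covered if \<open>[n, c, s]\<close> is a P-position for some \<open>s < b\<close>. Column \<open>a\<close> is not
  covered; let \<open>c\<close> be the largest uncovered column below \<open>n\<close>. For each \<open>c' \<in> {c<..n}\<close> there is
  then a P-position \<open>[n, c', s]\<close> with \<open>s \<le> b\<close>, and the only way for \<open>[n, c, s]\<close> to be an N-position
  is that \<open>[m, c, s]\<close> is a P-position for some \<open>m \<in> {c<..<n}\<close>. The map \<open>c' \<mapsto> m\<close> is injective, but
  there are \<open>n - c\<close> choices of \<open>c'\<close> and only \<open>n - c - 1\<close> values of \<open>m\<close>.
\<close>

lemma P_position_chompD:
  "P_position b \<Longrightarrow> s \<in> squares b \<Longrightarrow> \<not> P_position (chomp s b)"
  using P_position.simps[of b] by blast

lemma P_position_row1D: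
  assumes "P_position (p, q, r)" "valid_position (p, q, r)" "x < p"
  shows "\<not> P_position (x, min x q, min x r)"
  using P_position_chompD[OF assms(1)] chomp_row1[OF assms(2,3)] by metis

lemma P_position_row2D:
  assumes "P_position (p, q, r)" "valid_position (p, q, r)" "x < q"
  shows "\<not> P_position (p, x, min x r)"
  using P_position_chompD[OF assms(1)] chomp_row2[OF assms(2,3)] by metis

lemma P_position_row3D:
  assumes "P_position (p, q, r)" "valid_position (p, q, r)" "x < r"
  shows "\<not> P_position (p, q, x)"
  using P_position_chompD[OF assms(1)] chomp_row3[OF assms(2,3)] by metis

lemma squares_cases:
  assumes "valid_position (p, q, r)" "s \<in> squares (p, q, r)"
  obtains (row1) x where "x < p" "s = (1, x + 1)" "chomp s (p, q, r) = (x, min x q, min x r)"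
  | (row2) x where "x < q" "s = (2, x + 1)" "chomp s (p, q, r) = (p, x, min x r)"
  | (row3) x where "x < r" "s = (3, x + 1)" "chomp s (p, q, r) = (p, q, x)"
proof -
  obtain i j where s: "s = (i, j)" by (cases s)
  with assms(2) have j: "1 \<le> j"
    and ij: "i = 1 \<and> j \<le> p \<or> i = 2 \<and> j \<le> q \<or> i = 3 \<and> j \<le> r"
    by (auto simp: squares_def)
  define x where "x = j - 1"
  have jx: "j = x + 1" using j by (simp add: x_def)
  from ij consider "i = 1" "x < p" | "i = 2" "x < q" | "i = 3" "x < r"
    using jx by auto
  then show thesis
    using that chomp_row1[OF assms(1), of x] chomp_row2[OF assms(1), of x]
      chomp_row3[OF assms(1), of x] s jx
    by cases simp_all
qed

lemma N_position_cases:
  assumes "\<not> P_position (p, q, r)" "valid_position (p, q, r)" "0 < p"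
  obtains (row1) x where "x < p" "P_position (x, min x q, min x r)"
  | (row2) x where "x < q" "P_position (p, x, min x r)"
  | (row3) x where "x < r" "P_position (p, q, x)"
proof -
  from assms(1,3) obtain s where s: "s \<in> squares (p, q, r)" "P_position (chomp s (p, q, r))"
    by (subst (asm) P_position.simps) auto
  from assms(2) s(1) show thesis
    by (cases rule: squares_cases) (use s(2) that in auto)
qed

text \<open>Strategy stealing: if the rectangle were a P-position, removing its last corner square
  would give an N-position, but every reply from there leads to a board that the rectangle reaches
  in one move.\<close>

lemma not_P_position_rectangle: "\<not> P_position (n, n, n)"
proof (cases "n = 0")
  case True
  then show ?thesis using P_position.simps[of "(0, 0, 0)"] by simp
next
  case False
  have valid: "valid_position (n, n, n)" "valid_position (n, n, n - 1)"
    by (simp_all add: valid_position_def)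
  show ?thesis
  proof
    assume P: "P_position (n, n, n)"
    have "\<not> P_position (n, n, n - 1)" "0 < n"
      using P_position_row3D[OF P valid(1)] False by simp_all
    from this(1) valid(2) this(2) show False
    proof (cases rule: N_position_cases)
      case (row1 x)
      moreover have "min x (n - 1) = min x n" using row1(1) by simp
      ultimately show False using P_position_row1D[OF P valid(1) row1(1)] by simp
    next
      case (row2 x)
      moreover have "min x (n - 1) = min x n" using row2(1) by simp
      ultimately show False using P_position_row2D[OF P valid(1) row2(1)] by simp
    next
      case (row3 x)
      then show False using P_position_row3D[OF P valid(1), of x] by simp
    qed
  qed
qed

text \<open>\<open>(n, c, s)\<close> is an N-position, being a move away from
  \<open>(n, c', s)\<close>. A winning first-row cut to length at most \<open>c\<close>, or a
  winning second-row cut, would also be available from \<open>(n, c', s)\<close>;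
  \<open>none\<close> rules out the third row. Only a first-row cut to a length above
  \<open>c\<close> remains.\<close>

lemma P_position_row1_witness:
  assumes P: "P_position (n, c', s)" and c': "c < c'" "c' \<le> n" and s: "s \<le> c"
    and none: "\<And>t. t < s \<Longrightarrow> \<not> P_position (n, c, t)"
  shows "\<exists>m\<in>{c<..<n}. P_position (m, c, s)"
proof -
  have valid: "valid_position (n, c', s)" "valid_position (n, c, s)"
    using c' s by (simp_all add: valid_position_def)
  have "\<not> P_position (n, c, s)" "0 < n"
    using P_position_row2D[OF P valid(1) c'(1)] c' s by (simp_all add: min_absorb2)
  from this(1) valid(2) this(2) show ?thesis
  proof (cases rule: N_position_cases)
    case (row1 x)
    have "\<not> x \<le> c"
    proof
      assume "x \<le> c"
      then have "min x c = min x c'" using c' by simp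
      then show False using P_position_row1D[OF P valid(1) row1(1)] row1(2) by simp
    qed
    then show ?thesis using row1 s by (intro bexI[of _ x]) (auto simp: min_absorb2)
  next
    case (row2 x)
    then show ?thesis using P_position_row2D[OF P valid(1), of x] c' by simp
  next
    case (row3 x)
    then show ?thesis using none by blast
  qed
qed

lemma P_position_row3_unique:
  assumes "P_position (p, q, r)" "P_position (p, q, r')" "r \<le> q" "r' \<le> q" "q \<le> p"
  shows "r = r'"
proof (rule linorder_cases[of r r'])
  assume "r < r'"
  then show ?thesis using P_position_row3D[OF assms(2)] assms by (simp add: valid_position_def)
next
  assume "r' < r"
  then show ?thesis using P_position_row3D[OF assms(1)] assms by (simp add: valid_position_def)
qed

lemma P_position_row2_unique:
  assumes "P_position (p, q, r)" "P_position (p, q', r)" "r \<le> q" "r \<le> q'" "q \<le> p" "q' \<le> p"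
  shows "q = q'"
proof (rule linorder_cases[of q q'])
  assume "q < q'"
  then show ?thesis
    using P_position_row2D[OF assms(2), of q] assms by (simp add: valid_position_def min_absorb2)
next
  assume "q' < q"
  then show ?thesis
    using P_position_row2D[OF assms(1), of q'] assms by (simp add: valid_position_def min_absorb2)
qed

lemma column_covered:
  assumes P: "P_position (n, n, b)" and "b \<le> a" "a < n"
  shows "\<exists>s<b. P_position (n, a, s)"
proof (rule ccontr)
  assume *: "\<not> ?thesis"
  \<comment> \<open>The bound \<open>b \<le> c\<close> makes every \<open>(n, c, s)\<close> with
    \<open>s \<le> b\<close> a board.\<close>
  define U where "U = {c. b \<le> c \<and> c < n \<and> \<not> (\<exists>s<b. P_position (n, c, s))}"
  define c where "c = Max U"
  have "finite U" by (simp add: U_def)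
  moreover have "a \<in> U" using * assms by (simp add: U_def)
  ultimately have "c \<in> U" and max: "\<And>d. d \<in> U \<Longrightarrow> d \<le> c"
    unfolding c_def by (auto intro: Max_in)
  then have c: "b \<le> c" "c < n" and none: "\<And>s. s < b \<Longrightarrow> \<not> P_position (n, c, s)"
    by (auto simp: U_def)
  have "\<exists>s\<le>b. P_position (n, c', s)" if "c' \<in> {c<..n}" for c'
  proof (cases "c' = n")
    \<comment> \<open>The last column is served by \<open>b\<close> itself, hence
      \<open>s \<le> b\<close> and not \<open>s < b\<close>.\<close>
    case True
    then show ?thesis using P by auto
  next
    case False
    then have "c' \<notin> U" "c' < n" using that max[of c'] by auto
    then show ?thesis using that c(1) unfolding U_def by force
  qed
  then obtain \<sigma> where \<sigma>: "\<And>c'. c' \<in> {c<..n} \<Longrightarrow> \<sigma> c' \<le> b \<and> P_position (n, c', \<sigma> c')"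
    by metis
  have "\<exists>m\<in>{c<..<n}. P_position (m, c, \<sigma> c')" if "c' \<in> {c<..n}" for c'
    using \<sigma>[OF that] that c none by (intro P_position_row1_witness[of n c']) auto
  then obtain \<tau> where \<tau>: "\<And>c'. c' \<in> {c<..n} \<Longrightarrow> \<tau> c' \<in> {c<..<n} \<and> P_position (\<tau> c', c, \<sigma> c')"
    by metis
  have "inj_on \<tau> {c<..n}"
  proof
    fix x y assume xy: "x \<in> {c<..n}" "y \<in> {c<..n}" and eq: "\<tau> x = \<tau> y"
    \<comment> \<open>Equal first and second rows force equal third rows; then
      \<open>(n, x, \<sigma> x)\<close> and \<open>(n, y, \<sigma> x)\<close> differ only in the
      second row.\<close>
    have "\<sigma> x = \<sigma> y"
      by (rule P_position_row3_unique[of "\<tau> x" c])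
        (use \<tau>[OF xy(1)] \<tau>[OF xy(2)] \<sigma>[OF xy(1)] \<sigma>[OF xy(2)] eq c in auto)
    then show "x = y"
      by (intro P_position_row2_unique[of n x "\<sigma> x" y])
        (use \<sigma>[OF xy(1)] \<sigma>[OF xy(2)] xy c in auto)
  qed
  then have "card {c<..n} \<le> card {c<..<n}"
    by (rule card_inj_on_le) (use \<tau> in auto)
  then show False using c by simp
qed

lemma P_position_row2_row3_exclusive:
  assumes "P_position (n, a, a)" "a < n" "b < n"
  shows "\<not> P_position (n, n, b)"
proof
  assume P: "P_position (n, n, b)"
  show False
  proof (cases "b \<le> a")
    case True
    then obtain s where "s < b" "P_position (n, a, s)"
      using column_covered[OF P] assms(2) by blast
    then show False
      using P_position_row3_unique[OF assms(1), of s] assms(2) True by simp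
  next
    \<comment> \<open>As \<open>a < b\<close>, cutting the second row of \<open>(n, n, b)\<close> to
      \<open>a\<close> cuts the third to \<open>a\<close> too, giving
      \<open>(n, a, a)\<close>.\<close>
    case False
    then show False
      using P_position_row2D[OF P, of a] assms by (simp add: valid_position_def)
  qed
qed

lemma P_position_row2_square_unique:
  assumes "P_position (n, a, a)" "P_position (n, a', a')" "a < n" "a' < n"
  shows "a = a'"
proof (rule linorder_cases[of a a'])
  assume "a < a'"
  then show ?thesis
    using P_position_row2D[OF assms(2), of a] assms by (simp add: valid_position_def)
next
  assume "a' < a"
  then show ?thesis
    using P_position_row2D[OF assms(1), of a'] assms by (simp add: valid_position_def)
qed

theorem theorem1p1:
  fixes n :: nat
  assumes "n > 0"
  shows "\<exists>!s. winning_move (n, n, n) s"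
proof -
  have valid: "valid_position (n, n, n)" by (simp add: valid_position_def)
  have ex: "\<exists>s. winning_move (n, n, n) s"
    using not_P_position_rectangle[of n] assms P_position.simps[of "(n, n, n)"]
    by (auto simp: winning_move_def)
  \<comment> \<open>A first-row move leaves a smaller rectangle, which is never a
    P-position.\<close>
  have shape: "(\<exists>a<n. s = (2, a + 1) \<and> P_position (n, a, a)) \<or>
      (\<exists>b<n. s = (3, b + 1) \<and> P_position (n, n, b))" if "winning_move (n, n, n) s" for s
  proof -
    have "s \<in> squares (n, n, n)" and P: "P_position (chomp s (n, n, n))"
      using that by (simp_all add: winning_move_def)
    with valid show ?thesis
      by (cases rule: squares_cases) (auto simp: not_P_position_rectangle)
  qed
  have "s = t" if "winning_move (n, n, n) s" "winning_move (n, n, n) t" for s t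
    using shape[OF that(1)] shape[OF that(2)] P_position_row2_row3_exclusive[of n]
      P_position_row2_square_unique[of n] P_position_row3_unique[of n n] less_imp_le[of _ n]
    by (metis order_refl)
  with ex show ?thesis by blast
qed

end
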